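(* Let $\mu\in\mathbb{C}$ and let $m\ge0$, $n\ge1$ be integers. Then $$T_{m,n}^{(\mu)}(z)=(-1)^{n(n-1)/2}\,\mathrm{Wr}\left(L_{m+n}^{(n+\mu)}(z),L_{m+n-1}^{(n+\mu)}(z),\dots,L_{m+1}^{(n+\mu)}(z)\right)=\mathrm{Wr}\left(L_{m+1}^{(n+\mu)}(z),L_{m+2}^{(n+\mu)}(z),\dots,L_{m+n}^{(n+\mu)}(z)\right).$$
   Context: $L_n^{(\alpha)}(z)=\frac{z^{-\alpha}e^z}{n!}\frac{d^n}{dz^n}\left(z^{n+\alpha}e^{-z}\right)=\sum_{i=0}^n \frac{(-1)^i}{i!\,(n-i)!}\Big(\prod_{l=i+1}^{n}(\alpha+l)\Big)z^i$ is the associated Laguerre polynomial ($n\ge0$, any complex $\alpha$). The generalised Laguerre polynomial is $T_{m,n}^{(\mu)}(z)=\det\left[\frac{d^{j+k}}{dz^{j+k}}L_{m+n}^{(\mu+1)}(z)\right]_{j,k=0}^{n-1}$. $\mathrm{Wr}(f_1,\dots,f_r)=\det[f_k^{(j-1)}]_{j,k=1}^r$ is the Wronskian with respect to $z$. *)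

theory Defs
  imports Complex_Main "HOL-Computational_Algebra.Polynomial" "Jordan_Normal_Form.Determinant"
begin

text \<open>
  All functions of $z$ involved are polynomials, so they are elements of \<^typ>\<open>complex poly\<close>
  and $d/dz$ is \<^const>\<open>pderiv\<close>. Determinants are taken over the ring of polynomials, with
  rows and columns indexed from 0.
\<close>

text \<open>
  The explicit form of the Rodrigues formula
  $L_n^{(\alpha)}(z) = \frac{z^{-\alpha} e^z}{n!} \frac{d^n}{dz^n} (z^{n+\alpha} e^{-z})$;
  it makes sense for every complex $\alpha$. The argument order is $\alpha$, $n$.
\<close>

definition laguerre :: "complex \<Rightarrow> nat \<Rightarrow> complex poly" where
  "laguerre \<alpha> n =
     (\<Sum>i=0..n. monom ((-1) ^ i / (fact i * fact (n - i)) * (\<Prod>l=i+1..n. \<alpha> + of_nat l)) i)"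

definition gen_laguerre :: "complex \<Rightarrow> nat \<Rightarrow> nat \<Rightarrow> complex poly" where
  "gen_laguerre \<mu> m n = det (mat n n (\<lambda>(j, k). (pderiv ^^ (j + k)) (laguerre (\<mu> + 1) (m + n))))"

definition wronskian :: "complex poly list \<Rightarrow> complex poly" where
  "wronskian fs = det (mat (length fs) (length fs) (\<lambda>(j, k). (pderiv ^^ j) (fs ! k)))"

end

theory Submission
  imports Defs
begin

text \<open>
  The contiguous relations $L_N^{(a)} = L_N^{(a+1)} - L_{N-1}^{(a+1)}$ and
  $\frac{d}{dz} L_N^{(a)} = -L_{N-1}^{(a+1)}$ express the derivatives
  $f, f', \dots, f^{(n-1)}$ of $f = L_{m+n}^{(\mu+1)}$ as constant linear combinations of
  $L_{m+n}^{(n+\mu)}, \dots, L_{m+1}^{(n+\mu)}$, with a triangular coefficient matrix whose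
  diagonal is $1, -1, 1, \dots$. Since $T_{m,n}^{(\mu)} = \mathrm{Wr}(f, f', \dots, f^{(n-1)})$,
  multiplicativity of the determinant gives the first equality. The second one reverses the order of the columns.
\<close>

text \<open>A Pochhammer symbol can be unrolled at either end, which the coefficient comparisons
  below exploit.\<close>

lemma coeff_laguerre:
  "coeff (laguerre a n) i =
     (if i \<le> n then (-1) ^ i / (fact i * fact (n - i)) * pochhammer (a + of_nat i + 1) (n - i) else 0)"
proof -
  have "(\<Prod>l=i+1..n. a + of_nat l) = pochhammer (a + of_nat i + 1) (n - i)" if "i \<le> n"
    unfolding pochhammer_prod
    by (rule prod.reindex_bij_witness[of _ "\<lambda>l. l + i + 1" "\<lambda>l. l - i - 1"])
      (use that in \<open>auto simp: of_nat_diff\<close>)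
  then show ?thesis
    unfolding laguerre_def coeff_sum coeff_monom by (simp add: sum.delta)
qed

text \<open>For \<open>i \<le> N\<close> the three coefficients of z^i share the factor
  \<open>P\<close>; after clearing factorials the claim is a + i + 1 = (a + i + 2 + k) - (k +
  1).\<close>

lemma laguerre_Suc_contiguous:
  "laguerre a (Suc N) = laguerre (a + 1) (Suc N) - laguerre (a + 1) N"
proof (rule poly_eqI)
  fix i
  show "coeff (laguerre a (Suc N)) i = coeff (laguerre (a + 1) (Suc N) - laguerre (a + 1) N) i"
  proof (cases "i \<le> N")
    case True
    define k where "k = N - i"
    define P where "P = pochhammer (a + of_nat i + 2) k"
    have N: "N = i + k" using True by (simp add: k_def)
    have 1: "pochhammer (a + of_nat i + 1) (Suc k) = (a + of_nat i + 1) * P"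
      by (simp add: pochhammer_rec P_def add_ac)
    have 2: "pochhammer (a + 1 + of_nat i + 1) (Suc k) = P * (a + of_nat i + 2 + of_nat k)"
      by (simp add: pochhammer_rec' P_def add_ac mult.commute)
    have 3: "pochhammer (a + 1 + of_nat i + 1) k = P"
      by (simp add: P_def add_ac)
    have d: "Suc N - i = Suc k" "N - i = k" using N by auto
    have nz: "(1 + of_nat k :: complex) \<noteq> 0"
      using of_nat_neq_0[of k, where 'a = complex] by simp
    show ?thesis
      using True nz unfolding coeff_diff coeff_laguerre d 1 2 3
      by (simp add: divide_simps) (simp add: algebra_simps)
  next
    case False
    then show ?thesis by (auto simp: coeff_laguerre le_Suc_eq)
  qed
qed

lemma pderiv_laguerre_Suc: "pderiv (laguerre a (Suc N)) = - laguerre (a + 1) N"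
proof (rule poly_eqI)
  fix i
  have "(1 + of_nat i :: complex) \<noteq> 0"
    using of_nat_neq_0[of i, where 'a = complex] by simp
  then show "coeff (pderiv (laguerre a (Suc N))) i = coeff (- laguerre (a + 1) N) i"
    by (simp add: coeff_pderiv coeff_laguerre divide_simps add_ac)
qed

lemma higher_pderiv_laguerre:
  "k \<le> N \<Longrightarrow> (pderiv ^^ k) (laguerre a N) = (-1) ^ k * laguerre (a + of_nat k) (N - k)"
proof (induction k)
  case (Suc k)
  then have "N - k = Suc (N - Suc k)" by simp
  then have "pderiv (laguerre (a + of_nat k) (N - k)) = - laguerre (a + of_nat k + 1) (N - Suc k)"
    by (simp only: pderiv_laguerre_Suc)
  moreover have "pderiv ((-1) ^ k * p) = (-1) ^ k * pderiv p" for p :: "complex poly"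
    by (cases "even k") (simp_all add: pderiv_minus)
  ultimately show ?case using Suc by (simp add: add_ac)
qed simp

text \<open>Each use of the contiguous relation applies 1 - S, where S lowers the degree index by
  one; this is the binomial expansion of (1 - S)^p.\<close>

lemma laguerre_raise_parameter:
  "p \<le> N \<Longrightarrow> laguerre a N =
     (\<Sum>i\<le>p. (-1) ^ i * of_nat (p choose i) * laguerre (a + of_nat p) (N - i))"
proof (induction p arbitrary: a N)
  case (Suc p)
  then obtain M where N: "N = Suc M" "p \<le> M" by (cases N) auto
  define b where "b = a + of_nat (Suc p)"
  have b: "a + 1 + of_nat p = b" by (simp add: b_def)
  \<comment> \<open>The binomial index \<open>j\<close> is kept apart from the degree shift
    \<open>i\<close>, so that the two terms of Pascal's rule can be written with the same
    shift.\<close>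
  let ?t = "\<lambda>q j i. (-1) ^ i * of_nat (q choose j) * laguerre b (N - i) :: complex poly"
  have hi: "laguerre (a + 1) N = (\<Sum>i\<le>p. ?t p i i)"
    using Suc.IH[of N "a + 1"] Suc.prems by (simp only: b)
  have "laguerre (a + 1) M = - (\<Sum>i\<le>p. ?t p i (Suc i))"
    using Suc.IH[of M "a + 1"] N unfolding b by (simp add: sum_negf)
  moreover have "laguerre a N = laguerre (a + 1) N - laguerre (a + 1) M"
    unfolding N by (rule laguerre_Suc_contiguous)
  ultimately have "laguerre a N = (\<Sum>i\<le>p. ?t p i i) + (\<Sum>i\<le>p. ?t p i (Suc i))"
    using hi by simp
  \<comment> \<open>The extra term vanishes because \<open>p choose Suc p\<close> is 0.\<close>
  also have "(\<Sum>i\<le>p. ?t p i i) = (\<Sum>i\<le>Suc p. ?t p i i)"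
    by simp
  also have "\<dots> = ?t p 0 0 + (\<Sum>i\<le>p. ?t p (Suc i) (Suc i))"
    by (simp only: sum.atMost_Suc_shift)
  also have "\<dots> + (\<Sum>i\<le>p. ?t p i (Suc i)) = ?t (Suc p) 0 0 + (\<Sum>i\<le>p. ?t (Suc p) (Suc i) (Suc i))"
    unfolding binomial_Suc_Suc of_nat_add distrib_left distrib_right sum.distrib by simp
  also have "\<dots> = (\<Sum>i\<le>Suc p. ?t (Suc p) i i)"
    by (simp only: sum.atMost_Suc_shift)
  finally show ?case by (simp only: b_def)
qed simp

text \<open>The only nonzero entry of the first row is in the last column. Expanding there leaves
  the exchange matrix one size smaller, so the exponents add up to 0 + 1 + ... + (n - 1).\<close>

lemma det_exchange_mat:
  "det (mat n n (\<lambda>(i, j). if i + j + 1 = n then 1 else 0) :: 'a :: comm_ring_1 mat) =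
     (-1) ^ (n * (n - 1) div 2)"
proof (induction n)
  case (Suc n)
  let ?J = "\<lambda>n. mat n n (\<lambda>(i, j). if i + j + 1 = n then 1 else 0) :: 'a mat"
  have del: "mat_delete (?J (Suc n)) 0 n = ?J n"
    by (rule eq_matI) (auto simp: mat_delete_def)
  have "det (?J (Suc n)) = (\<Sum>j<Suc n. ?J (Suc n) $$ (0, j) * cofactor (?J (Suc n)) 0 j)"
    by (rule laplace_expansion_row) auto
  also have "\<dots> = (\<Sum>j<Suc n. if j = n then cofactor (?J (Suc n)) 0 n else 0)"
    by (rule sum.cong) auto
  also have "\<dots> = (-1) ^ n * det (?J n)"
    by (simp add: cofactor_def del[simplified])
  also have "\<dots> = (-1) ^ (n + n * (n - 1) div 2)"
    by (simp only: Suc.IH power_add)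
  also have "n + n * (n - 1) div 2 = Suc n * (Suc n - 1) div 2"
  proof -
    have "(n * 2 + n * (n - 1)) div 2 = n + n * (n - 1) div 2" by simp
    moreover have "n * 2 + n * (n - 1) = Suc n * (Suc n - 1)" by (cases n) auto
    ultimately show ?thesis by simp
  qed
  finally show ?case .
qed simp

lemma det_mult_mat:
  fixes A B :: "nat \<times> nat \<Rightarrow> 'a :: comm_ring_1"
  assumes "\<And>i k. i < n \<Longrightarrow> k < n \<Longrightarrow> C (i, k) = (\<Sum>j<n. A (i, j) * B (j, k))"
  shows "det (mat n n C) = det (mat n n A) * det (mat n n B)"
proof -
  have "mat n n C = mat n n A * mat n n B"
    by (rule eq_matI) (auto simp: assms scalar_prod_def atLeast0LessThan)
  then show ?thesis by (simp add: det_mult[of _ n])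
qed

text \<open>Reversing the columns is right multiplication by the exchange matrix.\<close>

lemma wronskian_rev:
  "wronskian (rev fs) = (-1) ^ (length fs * (length fs - 1) div 2) * wronskian fs"
proof -
  let ?n = "length fs"
  have "det (mat ?n ?n (\<lambda>(j, k). (pderiv ^^ j) (rev fs ! k))) =
      det (mat ?n ?n (\<lambda>(j, k). (pderiv ^^ j) (fs ! k))) *
      det (mat ?n ?n (\<lambda>(i, j). if i + j + 1 = ?n then 1 else 0))"
  proof (rule det_mult_mat, clarsimp)
    fix i k assume "k < ?n"
    then have "(\<Sum>j<?n. (pderiv ^^ i) (fs ! j) * (if Suc (j + k) = ?n then 1 else 0)) =
        (\<Sum>j<?n. if j = ?n - Suc k then (pderiv ^^ i) (fs ! j) else 0)"
      by (intro sum.cong) auto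
    with \<open>k < ?n\<close> show "(pderiv ^^ i) (rev fs ! k) =
        (\<Sum>j<?n. (pderiv ^^ i) (fs ! j) * (if Suc (j + k) = ?n then 1 else 0))"
      by (simp add: rev_nth)
  qed
  then show ?thesis
    by (simp only: wronskian_def length_rev det_exchange_mat mult.commute)
qed

text \<open>Differentiating \<open>k\<close> times raises the parameter to
  \<open>\<mu> + 1 + k\<close>; raising it by the remaining \<open>n - 1 - k\<close> reaches
  \<open>n + \<mu>\<close>. With \<open>r = k + i\<close> the signs combine to
  \<open>(-1) ^ r\<close>.\<close>

lemma higher_pderiv_laguerre_expansion:
  assumes "k < n"
  shows "(pderiv ^^ k) (laguerre (\<mu> + 1) (m + n)) =
    (\<Sum>r<n. smult (if k \<le> r then (-1) ^ r * of_nat ((n - 1 - k) choose (r - k)) else 0)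
       (laguerre (of_nat n + \<mu>) (m + n - r)))"
    (is "_ = (\<Sum>r<n. ?f r)")
proof -
  let ?p = "n - 1 - k"
  have par: "\<mu> + 1 + of_nat k + of_nat ?p = of_nat n + \<mu>"
    using assms by (simp add: of_nat_diff)
  have smult: "smult ((-1) ^ r * of_nat c) q = (-1) ^ r * (of_nat c * q)" for r c and q :: "complex poly"
    by (cases "even r") (simp_all add: of_nat_poly)
  have smult': "smult ((-1) ^ k * ((-1) ^ r * of_nat c)) q = (-1) ^ k * ((-1) ^ r * (of_nat c * q))"
    for r c and q :: "complex poly"
    using smult[of "k + r" c q] by (simp add: power_add mult.assoc)
  have "(pderiv ^^ k) (laguerre (\<mu> + 1) (m + n)) =
      (-1) ^ k * laguerre (\<mu> + 1 + of_nat k) (m + n - k)"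
    using assms by (intro higher_pderiv_laguerre) simp
  also have "laguerre (\<mu> + 1 + of_nat k) (m + n - k) =
      (\<Sum>i\<le>?p. (-1) ^ i * of_nat (?p choose i) * laguerre (of_nat n + \<mu>) (m + n - k - i))"
    using laguerre_raise_parameter[of ?p "m + n - k" "\<mu> + 1 + of_nat k"] assms
    by (simp only: par)
  also have "(-1) ^ k * \<dots> = (\<Sum>i\<le>?p. ?f (k + i))"
    unfolding sum_distrib_left by (rule sum.cong) (simp_all add: smult' power_add mult.assoc)
  also have "\<dots> = (\<Sum>r\<in>{k..<n}. ?f r)"
    by (rule sum.reindex_bij_witness[of _ "\<lambda>r. r - k" "\<lambda>i. k + i"]) (use assms in auto)
  also have "\<dots> = (\<Sum>r<n. ?f r)"
    by (rule sum.mono_neutral_left) auto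
  finally show ?thesis .
qed

theorem lemma3p2:
  fixes \<mu> :: complex and m n :: nat
  assumes "n \<ge> 1"
  shows "gen_laguerre \<mu> m n =
           (-1) ^ (n * (n - 1) div 2) *
             wronskian (map (\<lambda>i. laguerre (of_nat n + \<mu>) (m + n - i)) [0..<n])
       \<and> (-1) ^ (n * (n - 1) div 2) *
             wronskian (map (\<lambda>i. laguerre (of_nat n + \<mu>) (m + n - i)) [0..<n]) =
           wronskian (map (\<lambda>i. laguerre (of_nat n + \<mu>) (m + i)) [1..<n+1])"
proof
  let ?L = "\<lambda>i. laguerre (of_nat n + \<mu>) (m + n - i)"
  let ?c = "\<lambda>r k. if k \<le> r then (-1) ^ r * of_nat ((n - 1 - k) choose (r - k)) else 0 :: complex"
  \<comment> \<open>Column \<open>k\<close> holds the coordinates of the \<open>k\<close>-th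
    derivative of f in the polynomials \<open>?L r\<close>, as constant polynomials; entries above
    the diagonal are 0.\<close>
  let ?A = "mat n n (\<lambda>(r, k). [:?c r k:])"
  have "gen_laguerre \<mu> m n = det (mat n n (\<lambda>(j, r). (pderiv ^^ j) (?L r))) * det ?A"
    unfolding gen_laguerre_def
    \<comment> \<open>Entry (j, k) is the \<open>j\<close>-th derivative of the expansion of the
      \<open>k\<close>-th one, and constant coefficients pass through \<open>pderiv\<close>.\<close>
    by (rule det_mult_mat)
      (simp add: funpow_add higher_pderiv_laguerre_expansion higher_pderiv_sum higher_pderiv_smult)
  also have "mat n n (\<lambda>(j, r). (pderiv ^^ j) (?L r)) =
      mat n n (\<lambda>(j, k). (pderiv ^^ j) (map ?L [0..<n] ! k))"
    by (rule eq_matI) auto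
  also have "det \<dots> = wronskian (map ?L [0..<n])"
    by (simp add: wronskian_def)
  also have "det ?A = prod_list (diag_mat ?A)"
    by (rule det_lower_triangular[of n]) auto
  \<comment> \<open>On the diagonal the binomial coefficient is \<open>(n - 1 - r) choose 0\<close>,
    leaving only the sign.\<close>
  also have "\<dots> = (\<Prod>r<n. (-1) ^ r)"
    unfolding prod_list_diag_prod
    by (auto simp: atLeast0LessThan intro!: prod.cong) (metis minus_one_power_iff one_pCons minus_pCons minus_zero)
  also have "\<dots> = (-1) ^ (n * (n - 1) div 2)"
    by (simp add: power_sum[symmetric] Sum_Ico_nat atLeast0LessThan[symmetric])
  finally show "gen_laguerre \<mu> m n = (-1) ^ (n * (n - 1) div 2) * wronskian (map ?L [0..<n])"
    by (simp only: mult.commute)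
  \<comment> \<open>Position \<open>i\<close> of the reversed list has degree index m + n - (n - 1 -
    i) = m + (i + 1), hence the range from 1.\<close>
  have "rev (map ?L [0..<n]) = map (\<lambda>i. laguerre (of_nat n + \<mu>) (m + i)) [1..<n+1]"
    by (rule nth_equalityI) (auto simp: rev_nth simp del: upt_Suc)
  then show "(-1) ^ (n * (n - 1) div 2) * wronskian (map ?L [0..<n]) =
      wronskian (map (\<lambda>i. laguerre (of_nat n + \<mu>) (m + i)) [1..<n+1])"
    using wronskian_rev[of "map ?L [0..<n]"] by simp
qed

end
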